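(* Let $\mathbb{F}$ be a finite field and let $G=[g_{ij}]$ be a superregular $4\times4$ matrix over $\mathbb{F}$. For $i,j\in\{1,2,3,4\}$ let $m_{ij}$ be the determinant of the $3\times3$ submatrix of $G$ obtained by deleting row $i$ and column $j$, let $M_{ij}=g_{ij}m_{ij}$, and let $N_{ij}$ (for $i<j$) be the determinant of the $2\times 2$ submatrix of $G$ with rows $i,j$ and columns $i,j$. Assume $$M_{11}\neq M_{12},\qquad M_{34}\neq M_{44},\qquad M_{24}-M_{34}+M_{44}\neq0 .$$ Then $$G=\tilde A^{(34)}\tilde A^{(24)}\tilde A^{(23)}\tilde A^{(14)}\tilde A^{(13)}\tilde A^{(12)},$$ where the $2\times 2$ matrices $A^{(jk)}=[A^{(jk)}_{lm}]_{l,m=1,2}$ over $\mathbb{F}$ have entries \begin{align*} A^{(12)}_{12}&=\frac{g_{12}}{g_{11}},\quad A^{(12)}_{21}=\frac{m_{12}}{m_{11}},\quad A^{(13)}_{12}=\frac{g_{13}}{g_{11}},\quad A^{(13)}_{21}=\frac{m_{13}g_{11}}{M_{12}-M_{11}},\\ A^{(14)}_{11}&=g_{11},\quad A^{(14)}_{12}=g_{14},\quad A^{(14)}_{21}=\frac{g_{11}m_{14}}{M_{24}-M_{34}+M_{44}},\\ A^{(23)}_{12}&=\frac{(M_{11}-M_{12})\bigl(g_{23}(M_{24}-M_{34}+M_{44})-g_{13}g_{24}m_{14}\bigr)}{N_{12}(M_{24}-M_{34}+M_{44})m_{11}},\\ A^{(23)}_{21}&=\frac{m_{11}(g_{11}g_{32}g_{44}-g_{12}g_{31}g_{44}+g_{12}g_{34}g_{41}-g_{11}g_{34}g_{42})}{N_{34}(M_{11}-M_{12})},\\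 A^{(24)}_{11}&=\frac{m_{11}N_{12}}{M_{11}-M_{12}},\quad A^{(24)}_{12}=g_{24},\quad A^{(24)}_{21}=\frac{-m_{11}m_{24}N_{12}}{(M_{11}-M_{12})(M_{44}-M_{34})},\\ A^{(34)}_{11}&=\frac{N_{34}m_{44}}{M_{44}-M_{34}},\quad A^{(34)}_{12}=g_{34},\quad A^{(34)}_{21}=\frac{N_{34}m_{34}}{M_{44}-M_{34}},\quad A^{(34)}_{22}=g_{44}, \end{align*} and every entry $A^{(jk)}_{lm}$ not listed here equals $1$.
   Context: A matrix over a field is superregular if all of its minors (of all sizes, including the entries and the full determinant) are nonzero. For $1\le j<k\le4$ and a $2\times2$ matrix $A^{(jk)}$, $\tilde A^{(jk)}$ denotes the $4\times 4$ matrix that agrees with the identity matrix except that its submatrix on rows $j,k$ and columns $j,k$ is $A^{(jk)}$ (so the $(j,j),(j,k),(k,j),(k,k)$ entries are $A^{(jk)}_{11},A^{(jk)}_{12},A^{(jk)}_{21},A^{(jk)}_{22}$). *)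

theory Defs
  imports "Jordan_Normal_Form.Determinant" "Jordan_Normal_Form.DL_Submatrix"
begin

definition superregular :: "'a :: comm_ring_1 mat \<Rightarrow> bool" where
  "superregular G \<longleftrightarrow>
    (\<forall>I J. I \<subseteq> {..<dim_row G} \<longrightarrow> J \<subseteq> {..<dim_col G} \<longrightarrow> I \<noteq> {} \<longrightarrow> card I = card J
       \<longrightarrow> det (submatrix G I J) \<noteq> 0)"

text \<open>
  Library matrices are indexed from 0. The functions below take row and column
  numbers that start at 1 and are meant for such indices only.
\<close>

definition entry :: "'a mat \<Rightarrow> nat \<Rightarrow> nat \<Rightarrow> 'a" where
  "entry G i j = G $$ (i - 1, j - 1)"

definition complementary_minor :: "'a :: comm_ring_1 mat \<Rightarrow> nat \<Rightarrow> nat \<Rightarrow> 'a" where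
  "complementary_minor G i j = det (mat_delete G (i - 1) (j - 1))"

definition entry_times_minor :: "'a :: comm_ring_1 mat \<Rightarrow> nat \<Rightarrow> nat \<Rightarrow> 'a" where
  "entry_times_minor G i j = entry G i j * complementary_minor G i j"

definition principal_minor2 :: "'a :: comm_ring_1 mat \<Rightarrow> nat \<Rightarrow> nat \<Rightarrow> 'a" where
  "principal_minor2 G i j = det (submatrix G {i - 1, j - 1} {i - 1, j - 1})"

definition mat2 :: "'a \<Rightarrow> 'a \<Rightarrow> 'a \<Rightarrow> 'a \<Rightarrow> 'a mat" where
  "mat2 a b c d = mat_of_rows_list 2 [[a, b], [c, d]]"

definition embed4 :: "nat \<Rightarrow> nat \<Rightarrow> 'a :: {zero, one} mat \<Rightarrow> 'a mat" where
  "embed4 j k A = mat 4 4 (\<lambda>(r, c).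
     if r = j - 1 \<and> c = j - 1 then entry A 1 1
     else if r = j - 1 \<and> c = k - 1 then entry A 1 2
     else if r = k - 1 \<and> c = j - 1 then entry A 2 1
     else if r = k - 1 \<and> c = k - 1 then entry A 2 2
     else (1\<^sub>m 4) $$ (r, c))"

end

theory Submission
  imports Defs
begin

text \<open>
  Write \<open>P = M\<^sub>1\<^sub>1 - M\<^sub>1\<^sub>2\<close>, \<open>Q = M\<^sub>4\<^sub>4 - M\<^sub>3\<^sub>4\<close> and \<open>R = M\<^sub>2\<^sub>4 - M\<^sub>3\<^sub>4 + M\<^sub>4\<^sub>4\<close>. Expanding
  \<open>det G\<close> along the first row and along the last column gives \<open>R = P + M\<^sub>1\<^sub>3 = Q + M\<^sub>2\<^sub>4\<close>.
  The last three factors multiply to a matrix whose first row is that of \<open>G\<close>; the first three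
  multiply to a matrix whose \<open>r\<close>-th row, for \<open>r \<ge> 2\<close>, is
  \<open>(0, m\<^sub>1\<^sub>1 (g\<^sub>1\<^sub>1 g\<^sub>r\<^sub>2 - g\<^sub>1\<^sub>2 g\<^sub>r\<^sub>1) / P, g\<^sub>r\<^sub>3 - g\<^sub>r\<^sub>4 g\<^sub>1\<^sub>3 m\<^sub>1\<^sub>4 / R, g\<^sub>r\<^sub>4)\<close>.
  The latter follows from the orthogonality of columns 1 to 3 of \<open>G\<close> to the cofactors of the last
  column, and the product of the two halves is \<open>G\<close> because rows 2 to 4 are orthogonal to the
  cofactors of the first row.
\<close>

section \<open>Small minors and their nonvanishing under superregularity\<close>

lemma det_mat_2:
  assumes "A \<in> carrier_mat 2 2"
  shows "det A = A $$ (0, 0) * A $$ (1, 1) - A $$ (0, 1) * A $$ (1, 0)"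
proof -
  have "det A = (\<Sum>i<2. A $$ (i, 0) * cofactor A i 0)"
    using assms by (rule laplace_expansion_column) simp
  moreover have "det (mat_delete A 0 0) = A $$ (1, 1)" "det (mat_delete A 1 0) = A $$ (0, 1)"
    using assms by (subst det_single; auto simp: mat_delete_def)+
  ultimately show ?thesis
    by (simp add: numeral_2_eq_2 cofactor_def algebra_simps)
qed

lemma pick_0_insert:
  assumes "\<forall>x\<in>S. i < x"
  shows "pick (insert i S) 0 = i"
  using assms by (auto intro!: Least_equality simp: less_imp_le)

text \<open>An element below all of \<open>S\<close> shifts the increasing enumeration by one.
  Together with \<open>pick_0_insert\<close> this evaluates \<open>pick\<close> on literal index
  sets without unfolding \<open>LEAST\<close>.\<close>

lemma pick_Suc_insert:
  assumes "\<forall>x\<in>S. i < x" and "n < card S"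
  shows "pick (insert i S) (Suc n) = pick S n"
  using assms(2)
proof (induction n)
  case 0
  have "i \<notin> S"
    using assms(1) by blast
  moreover have "(a \<in> insert i S \<and> i < a) \<longleftrightarrow> a \<in> S" for a
    using assms(1) by auto
  ultimately show ?case
    using pick_0_insert[of S i] assms(1) by simp
next
  case (Suc n)
  then have "pick S n \<in> S"
    by (intro pick_in_set_le) simp
  then have "i < pick S n"
    using assms(1) by blast
  then have "(a \<in> insert i S \<and> pick S n < a) \<longleftrightarrow> (a \<in> S \<and> pick S n < a)" for a
    by auto
  moreover have "pick (insert i S) (Suc n) = pick S n"
    using Suc by simp
  ultimately show ?case
    unfolding pick.simps(2)[of _ "Suc n"] pick.simps(2)[of S n] by simp
qed

lemma superregularD:
  assumes "superregular G" "I \<subseteq> {..<dim_row G}" "J \<subseteq> {..<dim_col G}" "I \<noteq> {}" "card I = card J"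
  shows "det (submatrix G I J) \<noteq> 0"
  using assms unfolding superregular_def by blast

lemma superregular_entry:
  assumes "superregular G" "i < dim_row G" "j < dim_col G"
  shows "G $$ (i, j) \<noteq> 0"
proof -
  have "{k. k < dim_row G \<and> k \<in> {i}} = {i}" "{k. k < dim_col G \<and> k \<in> {j}} = {j}"
    using assms by auto
  then have sub: "submatrix G {i} {j} = mat 1 1 (\<lambda>(r, c). G $$ (pick {i} r, pick {j} c))"
    unfolding submatrix_def by (simp only: card.insert card.empty finite.emptyI) simp
  have "det (submatrix G {i} {j}) = G $$ (i, j)"
    unfolding sub by (subst det_single) (simp_all add: pick_0_insert del: pick.simps)
  moreover have "det (submatrix G {i} {j}) \<noteq> 0"
    using assms by (intro superregularD) auto
  ultimately show ?thesis
    by simp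
qed

lemma superregular_principal_minor2:
  assumes "superregular G" "1 \<le> i" "i < j" "j \<le> dim_row G" "j \<le> dim_col G"
  shows "principal_minor2 G i j \<noteq> 0"
  using assms unfolding principal_minor2_def by (intro superregularD) auto

lemma principal_minor2_eq:
  assumes "1 \<le> i" "i < j" "j \<le> dim_row G" "j \<le> dim_col G"
  shows "principal_minor2 G i j = entry G i i * entry G j j - entry G i j * entry G j i"
proof -
  have "{k. k < d \<and> (k = i - 1 \<or> k = j - 1)} = {i - 1, j - 1}" if "j \<le> d" for d
    using assms that by auto
  moreover have less: "i - 1 < j - 1"
    using assms by linarith
  ultimately have sub: "submatrix G {i - 1, j - 1} {i - 1, j - 1} =
      mat 2 2 (\<lambda>(r, c). G $$ (pick {i - 1, j - 1} r, pick {i - 1, j - 1} c))"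
    using assms by (simp add: submatrix_def numeral_2_eq_2)
  have "pick {i - 1, j - 1} 0 = i - 1" "pick {i - 1, j - 1} 1 = j - 1"
    using less by (simp_all add: pick_0_insert pick_Suc_insert del: pick.simps)
  then show ?thesis
    unfolding principal_minor2_def sub by (subst det_mat_2) (simp_all add: entry_def del: pick.simps)
qed

text \<open>The corner minor is the only 3x3 minor that is itself a factor of a denominator in the
  entries.\<close>

lemma superregular_complementary_minor_1_1:
  assumes "superregular G" "G \<in> carrier_mat 4 4"
  shows "complementary_minor G 1 1 \<noteq> 0"
proof -
  \<comment> \<open>Selecting indices 1, 2, 3 and deleting index 0 are the same shift, which
    identifies the submatrix with \<open>mat_delete\<close>.\<close>
  have pick: "pick {1, 2, 3} r = Suc r" if "r < 3" for r
  proof -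
    have "r = 0 \<or> r = Suc 0 \<or> r = Suc (Suc 0)"
      using that by linarith
    then show ?thesis
      by (auto simp: pick_0_insert pick_Suc_insert simp del: pick.simps)
  qed
  have "{k. k < 4 \<and> k \<in> {1, 2, 3}} = {1, 2, 3::nat}"
    by auto
  then have card: "card {k. k < 4 \<and> k \<in> {1, 2, 3::nat}} = 3"
    by simp
  have "submatrix G {1, 2, 3} {1, 2, 3} = mat 3 3 (\<lambda>(r, c). G $$ (Suc r, Suc c))"
    unfolding submatrix_def carrier_matD[OF assms(2)] card
    by (rule cong_mat) (simp_all only: split pick)
  moreover have "mat_delete G 0 0 = mat 3 3 (\<lambda>(r, c). G $$ (Suc r, Suc c))"
    unfolding mat_delete_def carrier_matD[OF assms(2)] by (rule cong_mat) simp_all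
  moreover have "det (submatrix G {1, 2, 3} {1, 2, 3}) \<noteq> 0"
    by (rule superregularD) (use assms in auto)
  ultimately show ?thesis
    by (simp add: complementary_minor_def)
qed

section \<open>Orthogonality of rows and columns to cofactors, read off from the adjugate\<close>

lemma row_expansion:
  assumes "G \<in> carrier_mat 4 4" "i \<in> {1, 2, 3, 4}"
  shows "entry G i 1 * complementary_minor G 1 1 - entry G i 2 * complementary_minor G 1 2
      + entry G i 3 * complementary_minor G 1 3 - entry G i 4 * complementary_minor G 1 4
    = (if i = 1 then det G else 0)"
proof -
  have "(G * adj_mat G) $$ (i - 1, 0) = (det G \<cdot>\<^sub>m 1\<^sub>m 4) $$ (i - 1, 0)"
    using adj_mat(2)[OF assms(1)] by simp
  then show ?thesis
    using assms
    by (auto simp: adj_mat_def cofactor_def scalar_prod_def entry_def complementary_minor_def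
        numeral_eq_Suc algebra_simps)
qed

text \<open>The last row of \<open>adj_mat G\<close> holds the cofactors of the last column of
  \<open>G\<close>; the sign of each term is that of its cofactor.\<close>

lemma column_expansion:
  assumes "G \<in> carrier_mat 4 4" "j \<in> {1, 2, 3, 4}"
  shows "- entry G 1 j * complementary_minor G 1 4 + entry G 2 j * complementary_minor G 2 4
      - entry G 3 j * complementary_minor G 3 4 + entry G 4 j * complementary_minor G 4 4
    = (if j = 4 then det G else 0)"
proof -
  have "(adj_mat G * G) $$ (3, j - 1) = (det G \<cdot>\<^sub>m 1\<^sub>m 4) $$ (3, j - 1)"
    using adj_mat(3)[OF assms(1)] by simp
  then show ?thesis
    using assms
    by (auto simp: adj_mat_def cofactor_def scalar_prod_def entry_def complementary_minor_def
        numeral_eq_Suc algebra_simps)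
qed

section \<open>Entrywise computation of the product of the six embedded factors\<close>

lemma mat4_mult:
  fixes a11 :: "'a :: comm_ring_1"
  shows "mat_of_rows_list 4 [[a11, a12, a13, a14], [a21, a22, a23, a24],
      [a31, a32, a33, a34], [a41, a42, a43, a44]]
    * mat_of_rows_list 4 [[b11, b12, b13, b14], [b21, b22, b23, b24],
      [b31, b32, b33, b34], [b41, b42, b43, b44]]
    = mat_of_rows_list 4
      [[a11*b11 + a12*b21 + a13*b31 + a14*b41, a11*b12 + a12*b22 + a13*b32 + a14*b42,
        a11*b13 + a12*b23 + a13*b33 + a14*b43, a11*b14 + a12*b24 + a13*b34 + a14*b44],
       [a21*b11 + a22*b21 + a23*b31 + a24*b41, a21*b12 + a22*b22 + a23*b32 + a24*b42,
        a21*b13 + a22*b23 + a23*b33 + a24*b43, a21*b14 + a22*b24 + a23*b34 + a24*b44],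
       [a31*b11 + a32*b21 + a33*b31 + a34*b41, a31*b12 + a32*b22 + a33*b32 + a34*b42,
        a31*b13 + a32*b23 + a33*b33 + a34*b43, a31*b14 + a32*b24 + a33*b34 + a34*b44],
       [a41*b11 + a42*b21 + a43*b31 + a44*b41, a41*b12 + a42*b22 + a43*b32 + a44*b42,
        a41*b13 + a42*b23 + a43*b33 + a44*b43, a41*b14 + a42*b24 + a43*b34 + a44*b44]]"
  by (intro eq_matI)
    (auto simp: mat_of_rows_list_def scalar_prod_def numeral_eq_Suc less_Suc_eq)

lemma embed4_mat2:
  "embed4 1 2 (mat2 a b c d) =
    mat_of_rows_list 4 [[a, b, 0, 0], [c, d, 0, 0], [0, 0, 1, 0], [0, 0, 0, 1]]"
  "embed4 1 3 (mat2 a b c d) =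
    mat_of_rows_list 4 [[a, 0, b, 0], [0, 1, 0, 0], [c, 0, d, 0], [0, 0, 0, 1]]"
  "embed4 1 4 (mat2 a b c d) =
    mat_of_rows_list 4 [[a, 0, 0, b], [0, 1, 0, 0], [0, 0, 1, 0], [c, 0, 0, d]]"
  "embed4 2 3 (mat2 a b c d) =
    mat_of_rows_list 4 [[1, 0, 0, 0], [0, a, b, 0], [0, c, d, 0], [0, 0, 0, 1]]"
  "embed4 2 4 (mat2 a b c d) =
    mat_of_rows_list 4 [[1, 0, 0, 0], [0, a, 0, b], [0, 0, 1, 0], [0, c, 0, d]]"
  "embed4 3 4 (mat2 a b c d) =
    mat_of_rows_list 4 [[1, 0, 0, 0], [0, 1, 0, 0], [0, 0, a, b], [0, 0, c, d]]"
  for a :: "'a :: {zero, one}"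
  by (intro eq_matI;
      auto simp: embed4_def mat2_def entry_def mat_of_rows_list_def numeral_eq_Suc less_Suc_eq)+

lemma mat4_eq_entries:
  assumes "G \<in> carrier_mat 4 4"
  shows "G = mat_of_rows_list 4
    [[entry G 1 1, entry G 1 2, entry G 1 3, entry G 1 4],
     [entry G 2 1, entry G 2 2, entry G 2 3, entry G 2 4],
     [entry G 3 1, entry G 3 2, entry G 3 3, entry G 3 4],
     [entry G 4 1, entry G 4 2, entry G 4 3, entry G 4 4]]"
  using assms
  by (intro eq_matI) (auto simp: mat_of_rows_list_def entry_def numeral_eq_Suc less_Suc_eq)

text \<open>Here (a, b, c, d) is a row of \<open>G\<close> below the first and (0, k, l, d) the same
  row of the left half. The conclusions are columns 1 to 3 of its product with the right half, whose
  lower rows are built from \<open>q\<close>, \<open>t\<close> and \<open>u\<close>.\<close>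

lemma row_of_right_factor:
  fixes a b c d g11 g12 g13 m11 m12 m13 m14 P R t :: "'a :: field"
  assumes ortho: "a * m11 - b * m12 + c * m13 - d * m14 = 0"
    and P: "P = g11 * m11 - g12 * m12" and R: "R = P + g13 * m13"
    and nz: "g11 \<noteq> 0" "m11 \<noteq> 0" "P \<noteq> 0" "R \<noteq> 0"
    and tP: "t * P = - m13 * g11"
  defines "k \<equiv> m11 * (g11 * b - g12 * a) / P"
  defines "l \<equiv> c - d * g13 * m14 / R"
  defines "q \<equiv> m12 / m11"
  defines "u \<equiv> g11 * m14 / R"
  shows "k * q + l * t + d * u = a"
    and "k + l * (t * (g12 / g11)) + d * (u * (g12 / g11)) = b"
    and "l + d * (u * (g13 / g11)) = c"
proof -
  define w where "w = m14 / R"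
  have wR: "w * (P + g13 * m13) = m14"
    using nz by (simp add: w_def R)
  have kP: "k * P = m11 * (g11 * b - g12 * a)"
    using nz by (simp add: k_def)
  have qm: "q * m11 = m12"
    using nz by (simp add: q_def)
  have l: "l = c - d * g13 * w" and u: "u = g11 * w"
    by (simp_all add: l_def u_def w_def)
  \<comment> \<open>Multiplying by \<open>P\<close> clears the denominators of \<open>k\<close> and
    \<open>t\<close>; what remains is \<open>a * P\<close> up to a multiple of
    \<open>ortho\<close>.\<close>
  have "(k * q + l * t + d * u) * P = k * P * q + (c - d * g13 * w) * (t * P) + d * g11 * w * P"
    by (simp add: l u algebra_simps)
  also have "\<dots> = (g11 * b - g12 * a) * (q * m11) - c * m13 * g11 + d * g11 * (w * (P + g13 * m13))"
    unfolding kP tP by (simp add: algebra_simps)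
  also have "\<dots> = a * P - g11 * (a * m11 - b * m12 + c * m13 - d * m14)"
    unfolding qm wR by (simp add: P algebra_simps)
  finally have "(k * q + l * t + d * u) * P = a * P"
    by (simp add: ortho)
  then show first: "k * q + l * t + d * u = a"
    using nz by simp
  \<comment> \<open>Since \<open>g11 - g12 * q\<close> equals \<open>P / m11\<close>, the factor
    \<open>P\<close> in \<open>k\<close> cancels. Inserting the first conclusion for
    \<open>a\<close> then yields column 2.\<close>
  have "k * (g11 - g12 * q) * (P * m11) = k * P * (g11 * m11 - g12 * (q * m11))"
    by (simp add: algebra_simps)
  also have "\<dots> = (g11 * b - g12 * a) * (P * m11)"
    unfolding kP qm by (simp add: P)
  finally have "k * (g11 - g12 * q) = g11 * b - g12 * a"
    using nz by simp
  moreover have "g12 * a = g12 * (k * q + l * t + d * u)"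
    by (simp add: first)
  ultimately have "g11 * k + l * t * g12 + d * u * g12 = g11 * b"
    by (simp add: algebra_simps)
  then show "k + l * (t * (g12 / g11)) + d * (u * (g12 / g11)) = b"
    using nz by (simp add: field_simps)
  show "l + d * (u * (g13 / g11)) = c"
    using nz by (simp add: l u)
qed

text \<open>Rows 3 and 4 of the left half have the same shape, so one computation serves both: (m,
  g) is (m44, g34) for row 3 and (m34, g44) for row 4, with \<open>n\<close> the minor N34. The
  conclusions are columns 2 and 3.\<close>

lemma row_of_left_factor:
  fixes n :: "'a :: field"
  assumes K: "m * K = Q * h + m24 * N12 * g"
    and col3: "n * m = g * (g23 * m24 - g13 * m14) + Q * g3"
    and Q: "Q \<noteq> 0" and R: "R = g24 * m24 + Q" "R \<noteq> 0"
    and nz: "P \<noteq> 0" "N12 \<noteq> 0" "m11 \<noteq> 0" "n \<noteq> 0"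
  shows "n * m / Q * (m11 * K / (n * P)) + g * (- m11 * m24 * N12 / (P * Q)) = m11 * h / P" (is ?A)
    and "n * m / Q + g * ((- m11 * m24 * N12 / (P * Q))
      * (P * (g23 * R - g13 * g24 * m14) / (N12 * R * m11))) = g3 - g * g13 * m14 / R" (is ?B)
proof -
  have "n * m / Q * (m11 * K / (n * P)) = m11 * (m * K) / (P * Q)"
    using nz by (simp add: ac_simps)
  also have "\<dots> + g * (- m11 * m24 * N12 / (P * Q)) = m11 * (m * K - m24 * N12 * g) / (P * Q)"
    by (simp add: right_diff_distrib diff_divide_distrib ac_simps)
  also have "\<dots> = m11 * h * Q / (P * Q)"
    by (simp add: K)
  finally show ?A
    using Q by simp
  have "g * ((- m11 * m24 * N12 / (P * Q)) * (P * (g23 * R - g13 * g24 * m14) / (N12 * R * m11)))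
      = - g * m24 * (g23 * R - g13 * g24 * m14) / (Q * R)"
    using Q R(2) nz by simp
  then have "n * m / Q + g * ((- m11 * m24 * N12 / (P * Q))
      * (P * (g23 * R - g13 * g24 * m14) / (N12 * R * m11)))
      = (n * m * R - g * m24 * (g23 * R - g13 * g24 * m14)) / (Q * R)"
    using Q R(2) by (simp add: field_simps)
  also have "n * m * R - g * m24 * (g23 * R - g13 * g24 * m14) = (g3 * R - g * g13 * m14) * Q"
    unfolding col3 R(1) by (simp add: algebra_simps)
  also have "\<dots> / (Q * R) = g3 - g * g13 * m14 / R"
    using Q R(2) by (simp add: field_simps)
  finally show ?B .
qed

text \<open>All quotients are abstracted into ring equations, which separates the matrix product
  from the field arithmetic. Assumptions 3 to 8 describe the left half; those from 9 on say that the
  halves multiply to the lower rows.\<close>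

lemma mat4_factorization:
  fixes g11 :: "'a :: comm_ring_1"
  assumes "g11 * p = g12" "g11 * s = g13"
    and "\<alpha> = k2" "\<alpha> * x = l2"
    and "\<delta> * y + g34 * \<gamma> = k3" "\<delta> + g34 * (\<gamma> * x) = l3"
    and "\<epsilon> * y + g44 * \<gamma> = k4" "\<epsilon> + g44 * (\<gamma> * x) = l4"
    and "k2 * q + l2 * t + g24 * u = g21" "k2 + l2 * (t * p) + g24 * (u * p) = g22"
      "l2 + g24 * (u * s) = g23"
    and "k3 * q + l3 * t + g34 * u = g31" "k3 + l3 * (t * p) + g34 * (u * p) = g32"
      "l3 + g34 * (u * s) = g33"
    and "k4 * q + l4 * t + g44 * u = g41" "k4 + l4 * (t * p) + g44 * (u * p) = g42"
      "l4 + g44 * (u * s) = g43"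
  shows "mat_of_rows_list 4 [[g11, g12, g13, g14], [g21, g22, g23, g24],
      [g31, g32, g33, g34], [g41, g42, g43, g44]]
    = embed4 3 4 (mat2 \<delta> g34 \<epsilon> g44) * embed4 2 4 (mat2 \<alpha> g24 \<gamma> 1) * embed4 2 3 (mat2 1 x y 1)
      * embed4 1 4 (mat2 g11 g14 u 1) * embed4 1 3 (mat2 1 s t 1) * embed4 1 2 (mat2 1 p q 1)"
    (is "?G = ?A34 * ?A24 * ?A23 * ?A14 * ?A13 * ?A12")
proof -
  have left: "?A34 * ?A24 * ?A23 = mat_of_rows_list 4 [[1, 0, 0, 0], [0, k2, l2, g24],
      [0, k3, l3, g34], [0, k4, l4, g44]]"
    unfolding embed4_mat2 mat4_mult by (simp add: ac_simps flip: assms(3-8))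
  have right: "?A14 * ?A13 * ?A12 = mat_of_rows_list 4 [[g11, g12, g13, g14], [q, 1, 0, 0],
      [t, t * p, 1, 0], [u, u * p, u * s, 1]]"
    unfolding embed4_mat2 mat4_mult by (simp flip: assms(1,2))
  have "(?A34 * ?A24 * ?A23) * (?A14 * ?A13 * ?A12) = ?G"
    unfolding left right mat4_mult by (simp add: assms(9-))
  moreover have "embed4 j k A \<in> carrier_mat 4 4" for j k and A :: "'a mat"
    by (simp add: embed4_def)
  ultimately show ?thesis
    by (simp add: assoc_mult_mat[of _ 4 4 _ 4 _ 4] mult_carrier_mat[of _ 4 4 _ 4])
qed

section \<open>Verification of the scalar identities for the prescribed entries\<close>

theorem mainTheorem6:
  fixes G :: "'a :: {field, finite} mat"
  assumes "G \<in> carrier_mat 4 4"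
    and "superregular G"
    and "entry_times_minor G 1 1 \<noteq> entry_times_minor G 1 2"
    and "entry_times_minor G 3 4 \<noteq> entry_times_minor G 4 4"
    and "entry_times_minor G 2 4 - entry_times_minor G 3 4 + entry_times_minor G 4 4 \<noteq> 0"
  shows
    "let g = entry G;
         m = complementary_minor G;
         M = entry_times_minor G;
         N = principal_minor2 G;
         A12 = mat2
           1 (g 1 2 / g 1 1)
           (m 1 2 / m 1 1) 1;
         A13 = mat2
           1 (g 1 3 / g 1 1)
           (m 1 3 * g 1 1 / (M 1 2 - M 1 1)) 1;
         A14 = mat2
           (g 1 1) (g 1 4)
           (g 1 1 * m 1 4 / (M 2 4 - M 3 4 + M 4 4)) 1;
         A23 = mat2
           1
           ((M 1 1 - M 1 2) * (g 2 3 * (M 2 4 - M 3 4 + M 4 4) - g 1 3 * g 2 4 * m 1 4)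
             / (N 1 2 * (M 2 4 - M 3 4 + M 4 4) * m 1 1))
           (m 1 1 * (g 1 1 * g 3 2 * g 4 4 - g 1 2 * g 3 1 * g 4 4
                     + g 1 2 * g 3 4 * g 4 1 - g 1 1 * g 3 4 * g 4 2)
             / (N 3 4 * (M 1 1 - M 1 2)))
           1;
         A24 = mat2
           (m 1 1 * N 1 2 / (M 1 1 - M 1 2)) (g 2 4)
           (- m 1 1 * m 2 4 * N 1 2 / ((M 1 1 - M 1 2) * (M 4 4 - M 3 4))) 1;
         A34 = mat2
           (N 3 4 * m 4 4 / (M 4 4 - M 3 4)) (g 3 4)
           (N 3 4 * m 3 4 / (M 4 4 - M 3 4)) (g 4 4)
     in G = embed4 3 4 A34 * embed4 2 4 A24 * embed4 2 3 A23
            * embed4 1 4 A14 * embed4 1 3 A13 * embed4 1 2 A12"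
proof -
  define g where "g = entry G"
  define m where "m = complementary_minor G"
  define M where "M = entry_times_minor G"
  define N where "N = principal_minor2 G"
  define P where "P = M 1 1 - M 1 2"
  define Q where "Q = M 4 4 - M 3 4"
  define R where "R = M 2 4 - M 3 4 + M 4 4"
  \<comment> \<open>\<open>h r\<close> is the minor on rows 1, r and columns 1, 2; thus
    \<open>h 1 = 0\<close> and \<open>h 2 = N 1 2\<close>.\<close>
  define h where "h r = g 1 1 * g r 2 - g 1 2 * g r 1" for r
  note G = assms(1)
  note defs = g_def m_def M_def N_def
  have M: "M i j = g i j * m i j" for i j
    by (simp add: defs entry_times_minor_def)
  have N: "N 1 2 = g 1 1 * g 2 2 - g 1 2 * g 2 1" "N 3 4 = g 3 3 * g 4 4 - g 3 4 * g 4 3"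
    using G by (simp_all add: defs principal_minor2_eq)
  have N_nz: "N 1 2 \<noteq> 0" "N 3 4 \<noteq> 0"
    using G assms(2) by (simp_all add: defs superregular_principal_minor2)
  have nz: "g 1 1 \<noteq> 0" "m 1 1 \<noteq> 0" "P \<noteq> 0" "Q \<noteq> 0" "R \<noteq> 0"
    using assms superregular_entry[of G 0 0] superregular_complementary_minor_1_1[of G]
    by (simp_all add: P_def Q_def R_def defs entry_def)
  note row = row_expansion[OF G, folded g_def m_def]
  note col = column_expansion[OF G, folded g_def m_def]
  have P: "P = g 1 1 * m 1 1 - g 1 2 * m 1 2" and Q: "Q = g 4 4 * m 4 4 - g 3 4 * m 3 4"
    by (simp_all only: P_def Q_def M)
  have RQ: "R = g 2 4 * m 2 4 + Q"
    by (simp add: R_def Q_def M)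
  have "det G = P + g 1 3 * m 1 3 - g 1 4 * m 1 4"
    using row[of 1] by (simp add: P)
  moreover have "det G = R - g 1 4 * m 1 4"
    using col[of 4] by (simp add: RQ Q algebra_simps)
  ultimately have RP: "R = P + g 1 3 * m 1 3"
    by simp
  have negP: "M 1 2 - M 1 1 = - P"
    by (simp add: P_def)
  \<comment> \<open>The denominator of the (2,1) entry of \<open>A13\<close> is \<open>- P\<close>,
    which accounts for the minus sign.\<close>
  have t: "m 1 3 * g 1 1 / (M 1 2 - M 1 1) * P = - m 1 3 * g 1 1"
    unfolding negP using nz(3) by simp
  have right:
    "g r 1 * m 1 1 - g r 2 * m 1 2 + g r 3 * m 1 3 - g r 4 * m 1 4 = 0" if "r \<in> {2, 3, 4}" for r
    using row[of r] that by auto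
  note right = row_of_right_factor[OF right P RP nz(1,2,3,5) t, folded h_def]
  \<comment> \<open>Combining the orthogonality relations of columns 2 and 1 with weights
    \<open>g 1 1\<close> and \<open>- g 1 2\<close> cancels the \<open>m 1 4\<close> terms.\<close>
  have "h 4 * m 4 4 - h 3 * m 3 4 + N 1 2 * m 2 4
      = g 1 1 * (- g 1 2 * m 1 4 + g 2 2 * m 2 4 - g 3 2 * m 3 4 + g 4 2 * m 4 4)
        - g 1 2 * (- g 1 1 * m 1 4 + g 2 1 * m 2 4 - g 3 1 * m 3 4 + g 4 1 * m 4 4)"
    unfolding h_def N by (simp only: algebra_simps) simp
  also have "\<dots> = 0"
    using col[of 1] col[of 2] by simp
  finally have cols12: "h 4 * m 4 4 - h 3 * m 3 4 + N 1 2 * m 2 4 = 0" .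
  \<comment> \<open>\<open>K\<close> is the bracket in the (2,1) entry of \<open>A23\<close>: a 2x2
    determinant in \<open>h 3\<close>, \<open>h 4\<close> and the last column of
    \<open>G\<close>.\<close>
  define K where "K = g 1 1 * g 3 2 * g 4 4 - g 1 2 * g 3 1 * g 4 4
    + g 1 2 * g 3 4 * g 4 1 - g 1 1 * g 3 4 * g 4 2"
  have K: "K = g 4 4 * h 3 - g 3 4 * h 4"
    by (simp add: K_def h_def algebra_simps)
  have "m 4 4 * K - (Q * h 3 + m 2 4 * N 1 2 * g 3 4)
      = - g 3 4 * (h 4 * m 4 4 - h 3 * m 3 4 + N 1 2 * m 2 4)"
    unfolding K Q by (simp add: algebra_simps)
  then have K3: "m 4 4 * K = Q * h 3 + m 2 4 * N 1 2 * g 3 4"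
    unfolding cols12 by simp
  have "m 3 4 * K - (Q * h 4 + m 2 4 * N 1 2 * g 4 4)
      = - g 4 4 * (h 4 * m 4 4 - h 3 * m 3 4 + N 1 2 * m 2 4)"
    unfolding K Q by (simp add: algebra_simps)
  then have K4: "m 3 4 * K = Q * h 4 + m 2 4 * N 1 2 * g 4 4"
    unfolding cols12 by simp
  have col3: "- g 1 3 * m 1 4 + g 2 3 * m 2 4 - g 3 3 * m 3 4 + g 4 3 * m 4 4 = 0"
    using col[of 3] by simp
  \<comment> \<open>The same elimination as for \<open>K\<close>, now with column 3 of
    \<open>G\<close> in place of the values of \<open>h\<close>.\<close>
  have "N 3 4 * m 4 4 - (g 3 4 * (g 2 3 * m 2 4 - g 1 3 * m 1 4) + Q * g 3 3)
      = - g 3 4 * (- g 1 3 * m 1 4 + g 2 3 * m 2 4 - g 3 3 * m 3 4 + g 4 3 * m 4 4)"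
    unfolding N Q by (simp add: algebra_simps)
  then have L3: "N 3 4 * m 4 4 = g 3 4 * (g 2 3 * m 2 4 - g 1 3 * m 1 4) + Q * g 3 3"
    unfolding col3 by simp
  have "N 3 4 * m 3 4 - (g 4 4 * (g 2 3 * m 2 4 - g 1 3 * m 1 4) + Q * g 4 3)
      = - g 4 4 * (- g 1 3 * m 1 4 + g 2 3 * m 2 4 - g 3 3 * m 3 4 + g 4 3 * m 4 4)"
    unfolding N Q by (simp add: algebra_simps)
  then have L4: "N 3 4 * m 3 4 = g 4 4 * (g 2 3 * m 2 4 - g 1 3 * m 1 4) + Q * g 4 3"
    unfolding col3 by simp
  note left3 = row_of_left_factor[OF K3 L3 nz(4) RQ nz(5,3) N_nz(1) nz(2) N_nz(2)]
  note left4 = row_of_left_factor[OF K4 L4 nz(4) RQ nz(5,3) N_nz(1) nz(2) N_nz(2)]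
  have N_h: "m 1 1 * N 1 2 / P = m 1 1 * h 2 / P"
    by (simp only: N h_def)
  have left2: "m 1 1 * N 1 2 / P * (P * (g 2 3 * R - g 1 3 * g 2 4 * m 1 4) / (N 1 2 * R * m 1 1))
      = g 2 3 - g 2 4 * g 1 3 * m 1 4 / R"
    using nz N_nz by (simp add: diff_divide_distrib ac_simps)
  have first_row: "g 1 1 * (g 1 2 / g 1 1) = g 1 2" "g 1 1 * (g 1 3 / g 1 1) = g 1 3"
    using nz(1) by simp_all
  have mem: "2 \<in> {2, 3, 4::nat}" "3 \<in> {2, 3, 4::nat}" "4 \<in> {2, 3, 4::nat}"
    by simp_all
  show ?thesis
    unfolding Let_def defs[symmetric] P_def[symmetric] Q_def[symmetric] R_def[symmetric]
      K_def[symmetric]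
    \<comment> \<open>The facts follow the order of the assumptions of
      \<open>mat4_factorization\<close>; \<open>left3\<close> and \<open>left4\<close> supply two
      each, every instance of \<open>right\<close> three.\<close>
    by (rule trans[OF mat4_eq_entries[OF G, folded g_def] mat4_factorization[OF first_row
          N_h left2 left3 left4 right[OF mem(1)] right[OF mem(2)] right[OF mem(3)]]])
qed

end
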